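(* Let $x_0\ge1$ be an integer, with associated word $w$ and real constant $K$. Assume that for every rational $\vartheta\in(0,1)$, every set $T\subseteq\mathcal{V}_{\mathbb{R}}(K,\vartheta)$ whose elements have pairwise distinct gaps (i.e. $c-a\ne c'-a'$ for any two distinct elements $(a,c),(a',c')$ of $T$) is finite. If $K$ is algebraic, then for every $C\in\mathbb{N}$ there is an integer $m\ge1$ with $P(w,m)>Cm$.
   Context: For an integer $x_0\ge 1$ define the orbit $(x_n)_{n\ge0}$ by $x_{n+1}=\lceil 3x_n/2\rceil$ for $n\ge 0$. The associated word is $w=(w_n)_{n\ge 0}$ with $w_n=2x_{n+1}-3x_n\in\{0,1\}$, equivalently $w_n=x_n \bmod 2$. The associated real constant is $K=x_0+\frac13\sum_{j\ge0}w_j(2/3)^j$, equivalently $K=\lim_{n\to\infty}x_n(2/3)^n$. The complexity $P(w,m)$ is the number of distinct vectors $(w_j,w_{j+1},\dots,w_{j+m-1})$ as $j$ ranges over all non-negative integers. For real $x$, $\lVert x\rVert$ denotes the distance from $x$ to the nearest integer. For real $\delta$ and rational $\vartheta$, with $\mathbb{N}=\{0,1,2,\dots\}$, $$\mathcal{V}_{\mathbb{R}}(\delta,\vartheta)=\Bigl\{(a,c)\in\mathbb{N}^2:\ 2\le a<c,\ \bigl\lVert\delta\bigl((3/2)^c-(3/2)^a\bigr)\bigr\rVert\le\vartheta^{\,c}\Bigr\}.$$ The gap of $(a,c)$ is $c-a$. *)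

theory Defs
  imports "HOL-Analysis.Analysis" "HOL-Computational_Algebra.Polynomial"
begin

primrec orbit :: "int \<Rightarrow> nat \<Rightarrow> int" where
  "orbit x0 0 = x0"
| "orbit x0 (Suc n) = \<lceil>3 * real_of_int (orbit x0 n) / 2\<rceil>"

definition word :: "int \<Rightarrow> nat \<Rightarrow> int" where
  "word x0 n = 2 * orbit x0 (Suc n) - 3 * orbit x0 n"

definition real_const :: "int \<Rightarrow> real" where
  "real_const x0 = real_of_int x0 + (1/3) * (\<Sum>j. real_of_int (word x0 j) * (2/3) ^ j)"

definition complexity :: "(nat \<Rightarrow> 'a) \<Rightarrow> nat \<Rightarrow> nat" where
  "complexity w m = card (range (\<lambda>j. map (\<lambda>i. w (j + i)) [0..<m]))"

definition dist_int :: "real \<Rightarrow> real" where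
  "dist_int x = \<bar>x - of_int (round x)\<bar>"

definition V_real :: "real \<Rightarrow> rat \<Rightarrow> (nat \<times> nat) set" where
  "V_real \<delta> \<theta> = {(a, c). 2 \<le> a \<and> a < c \<and>
     dist_int (\<delta> * ((3/2) ^ c - (3/2) ^ a)) \<le> of_rat \<theta> ^ c}"

definition gap :: "nat \<times> nat \<Rightarrow> nat" where
  "gap p = snd p - fst p"

text \<open>The facts below show that the series and the cardinality above are never junk values,
  and that the alternative descriptions of the word and of the constant agree with these.\<close>

lemma word_eq_mod_2: "word x0 n = orbit x0 n mod 2"
proof -
  have "2 * \<lceil>3 * real_of_int x / 2\<rceil> = 3 * x + x mod 2" for x :: int
  proof (cases "even x")
    case True
    then obtain k where k: "x = 2 * k" by blast
    have "\<lceil>3 * real_of_int x / 2\<rceil> = 3 * k"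
      by (rule ceiling_unique) (simp_all add: k)
    then show ?thesis by (simp add: k)
  next
    case False
    then obtain k where k: "x = 2 * k + 1" by (rule oddE)
    have "\<lceil>3 * real_of_int x / 2\<rceil> = 3 * k + 2"
      by (rule ceiling_unique) (simp_all add: k field_simps)
    then show ?thesis by (simp add: k)
  qed
  then show ?thesis by (simp add: word_def)
qed

lemma word_in: "word x0 n \<in> {0, 1}"
  by (auto simp: word_eq_mod_2)

lemma word_series_summable: "summable (\<lambda>j. real_of_int (word x0 j) * (2/3) ^ j)"
proof (rule summable_comparison_test')
  show "summable (\<lambda>j. (2/3::real) ^ j)" by (simp add: summable_geometric)
  show "norm (real_of_int (word x0 n) * (2/3) ^ n) \<le> (2/3) ^ n" if "n \<ge> 0" for n
    using word_in[of x0 n] by auto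
qed

lemma real_const_limit: "(\<lambda>n. real_of_int (orbit x0 n) * (2/3) ^ n) \<longlonglongrightarrow> real_const x0"
proof -
  have eq: "real_of_int (orbit x0 n) * (2/3) ^ n =
      real_of_int x0 + (1/3) * (\<Sum>j<n. real_of_int (word x0 j) * (2/3) ^ j)" for n
  proof (induction n)
    case (Suc n)
    have "2 * real_of_int (orbit x0 (Suc n)) =
        3 * real_of_int (orbit x0 n) + real_of_int (word x0 n)"
      by (simp add: word_def del: orbit.simps)
    then have "real_of_int (orbit x0 (Suc n)) =
        (3 * real_of_int (orbit x0 n) + real_of_int (word x0 n)) / 2"
      by simp
    then have "real_of_int (orbit x0 (Suc n)) * (2/3) ^ Suc n =
        real_of_int (orbit x0 n) * (2/3) ^ n + (1/3) * (real_of_int (word x0 n) * (2/3) ^ n)"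
      by (simp add: algebra_simps add_divide_distrib del: orbit.simps)
    with Suc.IH show ?case by (simp add: algebra_simps del: orbit.simps)
  qed simp
  show ?thesis
    unfolding eq real_const_def
    by (intro tendsto_intros summable_LIMSEQ word_series_summable)
qed

lemma finite_word_factors: "finite (range (\<lambda>j. map (\<lambda>i. word x0 (j + i)) [0..<m]))"
proof (rule finite_subset)
  show "range (\<lambda>j. map (\<lambda>i. word x0 (j + i)) [0..<m])
      \<subseteq> {xs. set xs \<subseteq> {0, 1} \<and> length xs = m}"
    using word_in by fastforce
  show "finite {xs. set xs \<subseteq> {0, 1::int} \<and> length xs = m}"
    by (rule finite_lists_length_eq) simp
qed

end

theory Submission
  imports Defs
begin

text \<open>If \<open>P(w, m) \<le> C m\<close> for all \<open>m\<close>, then by pigeonhole some factor of length \<open>m\<close> occurs at two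
  positions \<open>a < c\<close> of size \<open>O(m)\<close>. Such a repetition makes \<open>w\<close> periodic with period \<open>c - a\<close> on an
  interval of length \<open>m + c - a\<close>, so \<open>c - a\<close> may be replaced by a multiple of size at least \<open>m / 2\<close>
  while the common factor keeps length at least \<open>m / 2\<close>. The error \<open>K (3/2)^n - x_n\<close> is determined
  by the word from position \<open>n\<close> on, with the \<open>j\<close>-th letter weighted by \<open>(2/3)^j\<close>; hence
  \<open>K ((3/2)^c - (3/2)^a)\<close> is within \<open>(2/3)^(m / 2)\<close> of an integer, which is at most \<open>\<theta>^c\<close> for one
  fixed \<open>\<theta>\<close>. Letting \<open>m\<close> grow produces unboundedly many gaps for this \<open>\<theta>\<close>.\<close>

text \<open>Pigeonhole on the \<open>n\<close> starting positions from \<open>s\<close> onwards. The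
  offset \<open>s\<close> is left free because pairs in \<open>V_real\<close> need \<open>a\<close>
  to be at least 2.\<close>

lemma repeated_factor:
  assumes "finite (range (\<lambda>j. map (\<lambda>i. f (j + i)) [0..<m]))"
    and "complexity f m < n"
  obtains a c where "s \<le> a" "a < c" "c < s + n" "\<And>i. i < m \<Longrightarrow> f (a + i) = f (c + i)"
proof -
  let ?F = "\<lambda>j. map (\<lambda>i. f (j + i)) [0..<m]"
  have "card (?F ` {s..<s + n}) \<le> complexity f m"
    unfolding complexity_def by (rule card_mono) (use assms(1) in auto)
  then have "\<not> inj_on ?F {s..<s + n}"
    using assms(2) by (intro pigeonhole) simp
  then obtain a c where ac: "a \<in> {s..<s + n}" "c \<in> {s..<s + n}" "a < c" "?F a = ?F c"
    unfolding inj_on_def by (metis nat_neq_iff)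
  have "f (a + i) = f (c + i)" if "i < m" for i
    using arg_cong[OF ac(4), of "\<lambda>xs. xs ! i"] that by simp
  with ac that show thesis by simp
qed

lemma stretch_repetition:
  fixes f :: "nat \<Rightarrow> 'a"
  assumes "a < c" and rep: "\<And>i. i < 2 * n \<Longrightarrow> f (a + i) = f (c + i)"
  obtains d where "a + n < d" "d \<le> c + n" "\<And>i. i < n \<Longrightarrow> f (a + i) = f (d + i)"
proof -
  define g where "g = c - a"
  have g: "g > 0" "c = a + g" using \<open>a < c\<close> by (simp_all add: g_def)
  define q where "q = n div g"
  have q: "q * g \<le> n" "n < q * g + g"
    using g(1) dividend_less_div_times[of g n] by (simp_all add: q_def add.commute)
  \<comment> \<open>Chains \<open>k\<close> shifts by \<open>g\<close>; the side condition keeps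
    every intermediate shift within reach of \<open>rep\<close>.\<close>
  have per: "f (a + i) = f (a + k * g + i)" if "i + k * g < 2 * n + g" for i k
    using that
  proof (induction k)
    case (Suc k)
    have "f (a + i) = f (a + (i + k * g))"
      using Suc by (simp add: algebra_simps)
    also have "\<dots> = f (c + (i + k * g))"
      using Suc.prems by (intro rep) simp
    finally show ?case by (simp add: g(2) algebra_simps)
  qed simp
  \<comment> \<open>\<open>Suc q * g\<close> is the least multiple of \<open>g\<close> exceeding
    \<open>n\<close>. It is at most \<open>n + g\<close>, so \<open>per\<close> still covers all
    \<open>i < n\<close>.\<close>
  show thesis
  proof (rule that[of "a + Suc q * g"])
    show "f (a + i) = f (a + Suc q * g + i)" if "i < n" for i
      using that q by (intro per) simp
  qed (use q g in simp_all)
qed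

text \<open>This is the rescaled tail of the series for K: one third of the sum over j of
  \<open>word x0 (n + j) * (2/3) ^ j\<close>.\<close>

definition orbit_error :: "int \<Rightarrow> nat \<Rightarrow> real" where
  "orbit_error x0 n = real_const x0 * (3/2) ^ n - real_of_int (orbit x0 n)"

lemma orbit_Suc_eq:
  "real_of_int (orbit x0 (Suc n)) = (3 * real_of_int (orbit x0 n) + real_of_int (word x0 n)) / 2"
  by (simp add: word_def del: orbit.simps)

lemma orbit_error_step:
  "orbit_error x0 n = (2/3) * orbit_error x0 (Suc n) + real_of_int (word x0 n) / 3"
  by (simp add: orbit_error_def orbit_Suc_eq field_simps del: orbit.simps)

text \<open>K is squeezed between an increasing and a decreasing sequence,
  \<open>x_n * (2/3) ^ n\<close> and \<open>(x_n + 1) * (2/3) ^ n\<close>, both with limit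
  K.\<close>

lemma orbit_error_bounds: "0 \<le> orbit_error x0 n" "orbit_error x0 n \<le> 1"
proof -
  have w: "0 \<le> real_of_int (word x0 k)" "real_of_int (word x0 k) \<le> 1" for k
    using word_in[of x0 k] by auto
  have "incseq (\<lambda>n. real_of_int (orbit x0 n) * (2/3) ^ n)"
    using w by (intro incseq_SucI) (simp add: orbit_Suc_eq field_simps del: orbit.simps)
  then have lower: "real_of_int (orbit x0 n) * (2/3) ^ n \<le> real_const x0"
    by (rule incseq_le) (rule real_const_limit)
  have "decseq (\<lambda>n. (real_of_int (orbit x0 n) + 1) * (2/3) ^ n)"
    using w by (intro decseq_SucI) (simp add: orbit_Suc_eq field_simps del: orbit.simps)
  moreover have "(\<lambda>n. real_of_int (orbit x0 n) * (2/3) ^ n + (2/3) ^ n) \<longlonglongrightarrow> real_const x0 + 0"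
    by (intro tendsto_add real_const_limit LIMSEQ_power_zero) simp
  then have "(\<lambda>n. (real_of_int (orbit x0 n) + 1) * (2/3) ^ n) \<longlonglongrightarrow> real_const x0"
    by (simp add: algebra_simps)
  ultimately have upper: "real_const x0 \<le> (real_of_int (orbit x0 n) + 1) * (2/3) ^ n"
    by (rule decseq_ge)
  have pow: "(2/3::real) ^ n * (3/2) ^ n = 1"
    by (simp flip: power_mult_distrib)
  show "0 \<le> orbit_error x0 n"
    using mult_right_mono[OF lower, of "(3/2) ^ n"] pow
    by (simp add: orbit_error_def mult.assoc)
  show "orbit_error x0 n \<le> 1"
    using mult_right_mono[OF upper, of "(3/2) ^ n"] pow
    by (simp add: orbit_error_def mult.assoc)
qed

text \<open>Equal letters cancel in \<open>orbit_error_step\<close>, so each common letter contracts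
  the difference by 2/3; at the start it is at most 1, both errors lying in [0, 1].\<close>

lemma orbit_error_diff:
  assumes "\<And>i. i < n \<Longrightarrow> word x0 (a + i) = word x0 (c + i)"
  shows "\<bar>orbit_error x0 a - orbit_error x0 c\<bar> \<le> (2/3) ^ n"
  using assms
proof (induction n arbitrary: a c)
  case 0
  show ?case using orbit_error_bounds[of x0 a] orbit_error_bounds[of x0 c] by simp
next
  case (Suc n)
  have "\<bar>orbit_error x0 (Suc a) - orbit_error x0 (Suc c)\<bar> \<le> (2/3) ^ n"
    using Suc.prems[of "Suc i" for i] by (intro Suc.IH) simp
  moreover have "word x0 a = word x0 c" using Suc.prems[of 0] by simp
  then have "orbit_error x0 a - orbit_error x0 c
      = (2/3) * (orbit_error x0 (Suc a) - orbit_error x0 (Suc c))"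
    using orbit_error_step[of x0 a] orbit_error_step[of x0 c] by simp
  ultimately show ?case by (simp only: abs_mult power_Suc) simp
qed

lemma dist_int_repetition:
  assumes "\<And>i. i < n \<Longrightarrow> word x0 (a + i) = word x0 (c + i)"
  shows "dist_int (real_const x0 * ((3/2) ^ c - (3/2) ^ a)) \<le> (2/3) ^ n"
proof -
  have "dist_int (real_const x0 * ((3/2) ^ c - (3/2) ^ a))
      \<le> \<bar>real_const x0 * ((3/2) ^ c - (3/2) ^ a) - of_int (orbit x0 c - orbit x0 a)\<bar>"
    unfolding dist_int_def by (rule round_diff_minimal)
  also have "\<dots> = \<bar>orbit_error x0 a - orbit_error x0 c\<bar>"
    by (simp add: orbit_error_def algebra_simps)
  also have "\<dots> \<le> (2/3) ^ n" by (rule orbit_error_diff) (rule assms)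
  finally show ?thesis .
qed

lemma linear_complexity_large_gaps:
  assumes "\<And>m. m \<ge> 1 \<Longrightarrow> complexity (word x0) m \<le> C * m"
  obtains \<theta> :: rat where "0 < \<theta>" "\<theta> < 1" "infinite (gap ` V_real (real_const x0) \<theta>)"
proof -
  \<comment> \<open>The later position will satisfy \<open>d \<le> 2 + 2 * C * n + n\<close>, hence
    \<open>d \<le> D * n\<close>.\<close>
  define D where "D = 2 * C + 3"
  define t where "t = 1 - 1 / (3 * of_nat D :: real)"
  \<comment> \<open>By Bernoulli the \<open>D\<close>-th power is at least 1 - 1/3, so
    \<open>(2/3) ^ n\<close> is at most \<open>\<theta> ^ (D * n)\<close>. The real copy
    \<open>t\<close> carries the estimates.\<close>
  define \<theta> where "\<theta> = 1 - 1 / (3 * of_nat D :: rat)"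
  have t_eq: "of_rat \<theta> = t"
    by (simp add: \<theta>_def t_def of_rat_diff of_rat_divide of_rat_mult)
  have D: "D \<ge> 3" by (simp add: D_def)
  have \<theta>: "0 < \<theta>" "\<theta> < 1" using D by (simp_all add: \<theta>_def field_simps)
  have t: "0 < t" "t < 1" using D by (simp_all add: t_def field_simps)
  have "1 + real D * (- 1 / (3 * real D)) \<le> (1 + (- 1 / (3 * real D))) ^ D"
    by (rule Bernoulli_inequality) (use D in \<open>simp add: field_simps\<close>)
  then have tD: "2/3 \<le> t ^ D" using D by (simp add: t_def)
  have unbounded: "\<exists>g \<in> gap ` V_real (real_const x0) \<theta>. n < g" if n: "n \<ge> 2" for n
  proof -
    have "complexity (word x0) (2 * n) < Suc (C * (2 * n))"
      using assms[of "2 * n"] n by simp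
    from repeated_factor[OF finite_word_factors this, where s = 2]
    obtain a c where ac: "2 \<le> a" "a < c" "c < 2 + Suc (C * (2 * n))"
      "\<And>i. i < 2 * n \<Longrightarrow> word x0 (a + i) = word x0 (c + i)" by blast
    from stretch_repetition[OF ac(2,4)]
    obtain d where d: "a + n < d" "d \<le> c + n"
      "\<And>i. i < n \<Longrightarrow> word x0 (a + i) = word x0 (d + i)" by blast
    have "d \<le> D * n" using d(2) ac(3) n by (simp add: D_def algebra_simps)
    have "dist_int (real_const x0 * ((3/2) ^ d - (3/2) ^ a)) \<le> (2/3) ^ n"
      by (rule dist_int_repetition) (rule d(3))
    also have "\<dots> \<le> t ^ (D * n)"
      using power_mono[OF tD, of n] by (simp add: power_mult)
    also have "\<dots> \<le> t ^ d"
      using \<open>d \<le> D * n\<close> t by (intro power_decreasing) simp_all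
    finally have "(a, d) \<in> V_real (real_const x0) \<theta>"
      using ac(1) d(1) by (simp add: V_real_def t_eq)
    moreover have "n < gap (a, d)" using d(1) by (simp add: gap_def)
    ultimately show ?thesis by blast
  qed
  have "infinite (gap ` V_real (real_const x0) \<theta>)"
    unfolding infinite_nat_iff_unbounded
  proof
    fix k
    obtain g where "g \<in> gap ` V_real (real_const x0) \<theta>" "max 2 k < g"
      using unbounded[of "max 2 k"] by auto
    then show "\<exists>g>k. g \<in> gap ` V_real (real_const x0) \<theta>" by auto
  qed
  with \<theta> that show thesis by blast
qed

theorem theorem5p15:
  fixes x0 :: int
  assumes "x0 \<ge> 1"
    and "\<And>(\<theta>::rat) T. 0 < \<theta> \<Longrightarrow> \<theta> < 1 \<Longrightarrow> T \<subseteq> V_real (real_const x0) \<theta> \<Longrightarrow>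
           inj_on gap T \<Longrightarrow> finite T"
    and "algebraic (real_const x0)"
  shows "\<forall>C::nat. \<exists>m\<ge>1. complexity (word x0) m > C * m"
proof (rule ccontr)
  assume "\<not> ?thesis"
  then obtain C where C: "\<not> (\<exists>m\<ge>1. complexity (word x0) m > C * m)"
    unfolding not_all ..
  have "complexity (word x0) m \<le> C * m" if "m \<ge> 1" for m
    using C that not_le by blast
  then obtain \<theta> :: rat where \<theta>: "0 < \<theta>" "\<theta> < 1"
    and inf: "infinite (gap ` V_real (real_const x0) \<theta>)"
    by (rule linear_complexity_large_gaps)
  \<comment> \<open>Choosing one pair for each gap makes \<open>gap\<close> injective on
    \<open>T\<close> without losing any of the infinitely many gaps.\<close>
  have "\<exists>T \<subseteq> V_real (real_const x0) \<theta>. inj_on gap T \<and> gap ` V_real (real_const x0) \<theta> = gap ` T"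
    using subset_image_inj[THEN iffD1, OF subset_refl] .
  then obtain T where T: "T \<subseteq> V_real (real_const x0) \<theta>" "inj_on gap T"
    "gap ` V_real (real_const x0) \<theta> = gap ` T"
    by (elim exE conjE)
  then show False using assms(2)[OF \<theta> T(1,2)] inf by simp
qed

end
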